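(* Let $(X,G,\Phi)$ be a minimal equicontinuous action of a finitely generated infinite group $G$ on a Cantor set $X$, and let $\{G_i\}_{i\ge0}$ be a group chain associated to the action with partitions $\{\mathcal{P}_i\}_{i\ge0}$ and basepoint $x\in X$. Then the cardinality of the discriminant group $\mathcal{D}_x$ is independent of the choice of the partitions and of the basepoint.
   Context: $\Phi\colon G\times X\to X$ is an action by homeomorphisms; write $g\cdot x=\Phi(g)(x)$. The action is minimal if every orbit is dense, and equicontinuous (with respect to a metric $d$ on $X$) if for all $\varepsilon>0$ there is $\delta>0$ such that $d(u,v)<\delta$ implies $d(g\cdot u,g\cdot v)<\varepsilon$ for all $u,v\in X$, $g\in G$. A group chain in $G$ is a properly descending chain $G=G_0\supset G_1\supset G_2\supset\cdots$ of subgroups of finite index. A group chain associated to $(X,G,\Phi)$ with basepoint $x$ and partitions $\{\mathcal{P}_i\}_{i\ge0}$ is obtained from clopen sets $X=V_0\supset V_1\supset V_2\supset\cdots$ with $\bigcap_i V_i=\{x\}$ such that each $\mathcal{P}_i=\{g\cdot V_i\}_{g\in G}$ is a finite partition of $X$ and $\mathrm{diam}(g\cdot V_i)<2^{-i}$ for all $g\in G$, $i\ge1$, by setting $G_i=\{g\in G\mid g\cdot V_i=V_i\}$. For such a chain, let $C_i=\bigcap_{g\in G}gG_ig^{-1}$. The discriminant group of the chain at $x$ is the profinite group $\mathcal{D}_x=\varprojlim\{G_{i+1}/C_{i+1}\to G_i/C_i\}$, with bonding maps induced by inclusion of cosets. *)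

theory Defs
  imports
    "HOL-Analysis.Analysis"
    "HOL-Library.Disjoint_Sets"
    "HOL-Library.Equipollence"
    "HOL-Algebra.Group_Action"
    "HOL-Algebra.Generated_Groups"
begin

section \<open>Minimal equicontinuous Cantor actions\<close>

text \<open>A metric space \<open>(X, d)\<close> is a set \<open>X\<close> in a type of class \<open>metric_space\<close>, with
  \<open>d\<close> the restriction of \<open>dist\<close> to \<open>X\<close>.\<close>

definition cantor_set :: "'a::metric_space set \<Rightarrow> bool" where
  "cantor_set X \<longleftrightarrow>
     X \<noteq> {} \<and> compact X \<and>
     (\<forall>x\<in>X. connected_component_set X x = {x}) \<and>
     (\<forall>x\<in>X. x islimpt X)"

definition finitely_generated_group :: "('g, 'm) monoid_scheme \<Rightarrow> bool" where
  "finitely_generated_group G \<longleftrightarrow>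
     group G \<and> (\<exists>S\<subseteq>carrier G. finite S \<and> generate G S = carrier G)"

definition action_by_homeomorphisms ::
  "('g, 'm) monoid_scheme \<Rightarrow> 'a::topological_space set \<Rightarrow> ('g \<Rightarrow> 'a \<Rightarrow> 'a) \<Rightarrow> bool" where
  "action_by_homeomorphisms G X \<Phi> \<longleftrightarrow>
     group_action G X \<Phi> \<and> (\<forall>g\<in>carrier G. \<exists>h. homeomorphism X X (\<Phi> g) h)"

text \<open>\<open>closure\<close> is taken in the ambient space, so density in \<open>X\<close> is an inclusion.\<close>

definition minimal_action ::
  "('g, 'm) monoid_scheme \<Rightarrow> 'a::topological_space set \<Rightarrow> ('g \<Rightarrow> 'a \<Rightarrow> 'a) \<Rightarrow> bool" where
  "minimal_action G X \<Phi> \<longleftrightarrow> (\<forall>x\<in>X. X \<subseteq> closure (orbit G \<Phi> x))"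

definition equicontinuous_action ::
  "('g, 'm) monoid_scheme \<Rightarrow> 'a::metric_space set \<Rightarrow> ('g \<Rightarrow> 'a \<Rightarrow> 'a) \<Rightarrow> bool" where
  "equicontinuous_action G X \<Phi> \<longleftrightarrow>
     (\<forall>\<epsilon>>0. \<exists>\<delta>>0. \<forall>u\<in>X. \<forall>v\<in>X. \<forall>g\<in>carrier G.
        dist u v < \<delta> \<longrightarrow> dist (\<Phi> g u) (\<Phi> g v) < \<epsilon>)"

section \<open>Group chains\<close>

definition group_chain :: "('g, 'm) monoid_scheme \<Rightarrow> (nat \<Rightarrow> 'g set) \<Rightarrow> bool" where
  "group_chain G Gs \<longleftrightarrow>
     Gs 0 = carrier G \<and>
     (\<forall>i. Gs (Suc i) \<subset> Gs i) \<and>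
     (\<forall>i. subgroup (Gs i) G \<and> finite (rcosets\<^bsub>G\<^esub> (Gs i)))"

text \<open>The stabilizer below is that of \<open>V i\<close> as a set, i.e. for the induced action of \<open>G\<close> on
  subsets of \<open>X\<close>.\<close>

definition associated_group_chain ::
  "('g, 'm) monoid_scheme \<Rightarrow> 'a::metric_space set \<Rightarrow> ('g \<Rightarrow> 'a \<Rightarrow> 'a) \<Rightarrow>
   'a \<Rightarrow> (nat \<Rightarrow> 'a set set) \<Rightarrow> (nat \<Rightarrow> 'g set) \<Rightarrow> bool" where
  "associated_group_chain G X \<Phi> x P Gs \<longleftrightarrow>
     group_chain G Gs \<and>
     (\<exists>V. V 0 = X \<and>
          (\<forall>i. V (Suc i) \<subset> V i) \<and>
          (\<forall>i. openin (top_of_set X) (V i) \<and> closedin (top_of_set X) (V i)) \<and>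
          (\<Inter>i. V i) = {x} \<and>
          (\<forall>i. P i = {\<Phi> g ` V i | g. g \<in> carrier G}) \<and>
          (\<forall>i. finite (P i) \<and> partition_on X (P i)) \<and>
          (\<forall>i\<ge>1. \<forall>g\<in>carrier G. diameter (\<Phi> g ` V i) < 1 / 2 ^ i) \<and>
          (\<forall>i. Gs i = stabilizer G (\<lambda>g. image (\<Phi> g)) (V i)))"

section \<open>The discriminant group\<close>

definition normal_core :: "('g, 'm) monoid_scheme \<Rightarrow> 'g set \<Rightarrow> 'g set" where
  "normal_core G H = (\<Inter>g\<in>carrier G. g <#\<^bsub>G\<^esub> H #>\<^bsub>G\<^esub> inv\<^bsub>G\<^esub> g)"

definition inverse_limit ::
  "(nat \<Rightarrow> ('a, 'm) monoid_scheme) \<Rightarrow> (nat \<Rightarrow> 'a \<Rightarrow> 'a) \<Rightarrow> (nat \<Rightarrow> 'a) monoid" where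
  "inverse_limit K f =
     \<lparr>carrier = {s. \<forall>i. s i \<in> carrier (K i) \<and> f i (s (Suc i)) = s i},
      mult = (\<lambda>s t i. s i \<otimes>\<^bsub>K i\<^esub> t i),
      one = (\<lambda>i. \<one>\<^bsub>K i\<^esub>)\<rparr>"

definition chain_quotient ::
  "('g, 'm) monoid_scheme \<Rightarrow> (nat \<Rightarrow> 'g set) \<Rightarrow> nat \<Rightarrow> 'g set monoid" where
  "chain_quotient G Gs i = (G\<lparr>carrier := Gs i\<rparr>) Mod (normal_core G (Gs i))"

text \<open>A coset of \<open>C (i + 1)\<close> in \<open>Gs (i + 1)\<close> is sent to the coset of \<open>C i\<close> in \<open>Gs i\<close> that
  contains it, where \<open>C j\<close> is the normal core of \<open>Gs j\<close>.\<close>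

definition bonding_map ::
  "('g, 'm) monoid_scheme \<Rightarrow> (nat \<Rightarrow> 'g set) \<Rightarrow> nat \<Rightarrow> 'g set \<Rightarrow> 'g set" where
  "bonding_map G Gs i A = (THE B. B \<in> carrier (chain_quotient G Gs i) \<and> A \<subseteq> B)"

text \<open>Only the group is recorded here; its profinite topology is the one induced by the
  product of the discrete topologies.\<close>

definition discriminant_group ::
  "('g, 'm) monoid_scheme \<Rightarrow> (nat \<Rightarrow> 'g set) \<Rightarrow> (nat \<Rightarrow> 'g set) monoid" where
  "discriminant_group G Gs = inverse_limit (chain_quotient G Gs) (bonding_map G Gs)"

end

theory Submission
  imports Defs
begin

text \<open>By equicontinuity the uniform closure \<open>E\<close> of \<open>\<Phi>(G)\<close> is a group of homeomorphisms of \<open>X\<close>,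
  and by minimality and compactness it acts transitively, so the isotropy groups of \<open>E\<close> at any
  two points are conjugate. The core of \<open>G\<^sub>i\<close> is the kernel of the action of \<open>G\<close> on the
  partition \<open>P\<^sub>i\<close>, so a compatible sequence of cosets prescribes a compatible sequence of permutations of
  the partitions. As the cells shrink, such a sequence has a unique limit in \<open>E\<close>, which fixes
  \<open>x\<close> because the cosets lie in \<open>G\<^sub>i\<close>. This identifies the discriminant group of
  any chain at \<open>x\<close> with the isotropy group of \<open>E\<close> at \<open>x\<close>.\<close>

section \<open>Equicontinuous actions on compact metric spaces and the closure of the action\<close>

locale equicontinuous_compact_action =
  fixes G :: "('g, 'm) monoid_scheme" (structure)
    and X :: "'a::metric_space set"
    and \<Phi> :: "'g \<Rightarrow> 'a \<Rightarrow> 'a"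
  assumes action: "action_by_homeomorphisms G X \<Phi>"
    and compact_X: "compact X"
    and equicontinuous: "equicontinuous_action G X \<Phi>"
begin

sublocale group_action G X \<Phi>
  using action by (simp add: action_by_homeomorphisms_def)

sublocale group G
  using group_hom group_hom.axioms(1) by blast

lemma action_closed [simp]: "g \<in> carrier G \<Longrightarrow> y \<in> X \<Longrightarrow> \<Phi> g y \<in> X"
  using element_image by blast

lemma image_mult:
  "\<lbrakk>g \<in> carrier G; h \<in> carrier G; A \<subseteq> X\<rbrakk> \<Longrightarrow> \<Phi> (g \<otimes> h) ` A = \<Phi> g ` \<Phi> h ` A"
  unfolding image_image by (rule image_cong) (auto simp: composition_rule)

lemma action_inv_left:
  assumes "g \<in> carrier G" "y \<in> X"
  shows "\<Phi> (inv g) (\<Phi> g y) = y"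
  using assms orbit_sym_aux by blast

lemma action_inv_right:
  assumes "g \<in> carrier G" "y \<in> X"
  shows "\<Phi> g (\<Phi> (inv g) y) = y"
  using action_inv_left[of "inv g" y] assms by simp

lemma image_inv_eq_iff:
  assumes g: "g \<in> carrier G" and A: "A \<subseteq> X" and B: "B \<subseteq> X"
  shows "\<Phi> (inv g) ` A = B \<longleftrightarrow> A = \<Phi> g ` B"
proof -
  have "\<Phi> g ` \<Phi> (inv g) ` A = A" "\<Phi> (inv g) ` \<Phi> g ` B = B"
    unfolding image_image using g A B by (force simp: action_inv_left action_inv_right)+
  then show ?thesis
    by auto
qed

text \<open>By equicontinuity and compactness this uniform closure is the Ellis (enveloping) group
  of the action. Its members are made extensional so that maps equal on \<open>X\<close> are equal,
  which the later cardinality statements require.\<close>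

definition ellis :: "('a \<Rightarrow> 'a) set" where
  "ellis = {f \<in> extensional X. \<forall>\<epsilon>>0. \<exists>g\<in>carrier G. \<forall>y\<in>X. dist (f y) (\<Phi> g y) < \<epsilon>}"

lemma ellis_extensional: "f \<in> ellis \<Longrightarrow> f \<in> extensional X"
  by (simp add: ellis_def)

lemma ellisE:
  assumes "f \<in> ellis" "\<epsilon> > 0"
  obtains g where "g \<in> carrier G" "\<And>y. y \<in> X \<Longrightarrow> dist (f y) (\<Phi> g y) < \<epsilon>"
  using assms by (auto simp: ellis_def)

lemma ellis_closed:
  assumes f: "f \<in> ellis" and y: "y \<in> X"
  shows "f y \<in> X"
proof -
  have "\<exists>z\<in>X. dist z (f y) < \<epsilon>" if "\<epsilon> > 0" for \<epsilon>
    using ellisE[OF f that] y by (metis action_closed dist_commute)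
  then have "f y \<in> closure X"
    by (simp add: closure_approachable)
  then show ?thesis
    using compact_X by (simp add: compact_imp_closed)
qed

lemma equicontinuousE:
  assumes "\<epsilon> > 0"
  obtains \<delta> where "\<delta> > 0"
    "\<And>u v g. \<lbrakk>u \<in> X; v \<in> X; g \<in> carrier G; dist u v < \<delta>\<rbrakk> \<Longrightarrow> dist (\<Phi> g u) (\<Phi> g v) < \<epsilon>"
  using equicontinuous assms unfolding equicontinuous_action_def by meson

text \<open>Completeness of \<open>X\<close> gives pointwise limits, and the Cauchy estimate
  survives in the limit as a weak inequality; working with half of \<open>\<epsilon>\<close> makes
  it strict again.\<close>

lemma uniformly_Cauchy_action_limit:
  assumes s: "\<And>n. s n \<in> carrier G"
    and Cauchy: "\<And>\<epsilon>. \<epsilon> > 0 \<Longrightarrow> \<exists>N. \<forall>m\<ge>N. \<forall>n\<ge>N. \<forall>y\<in>X. dist (\<Phi> (s m) y) (\<Phi> (s n) y) < \<epsilon>"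
  shows "\<exists>f\<in>ellis. \<forall>y\<in>X. (\<lambda>n. \<Phi> (s n) y) \<longlonglongrightarrow> f y"
proof -
  have "\<exists>l. (\<lambda>n. \<Phi> (s n) y) \<longlonglongrightarrow> l" if y: "y \<in> X" for y
  proof -
    have "Cauchy (\<lambda>n. \<Phi> (s n) y)"
      unfolding Cauchy_def using Cauchy y by blast
    moreover have "complete X"
      using compact_X by (rule compact_imp_complete)
    ultimately show ?thesis
      using s y unfolding complete_def by (metis action_closed)
  qed
  then obtain l where l: "\<And>y. y \<in> X \<Longrightarrow> (\<lambda>n. \<Phi> (s n) y) \<longlonglongrightarrow> l y"
    by metis
  have "\<exists>g\<in>carrier G. \<forall>y\<in>X. dist (l y) (\<Phi> g y) < \<epsilon>" if "\<epsilon> > 0" for \<epsilon>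
  proof -
    from Cauchy[of "\<epsilon>/2"] that obtain N
      where N: "\<And>m n y. \<lbrakk>m \<ge> N; n \<ge> N; y \<in> X\<rbrakk> \<Longrightarrow> dist (\<Phi> (s m) y) (\<Phi> (s n) y) < \<epsilon>/2"
      by (metis half_gt_zero)
    have "dist (l y) (\<Phi> (s N) y) \<le> \<epsilon>/2" if "y \<in> X" for y
    proof (rule LIMSEQ_le_const2)
      show "(\<lambda>n. dist (\<Phi> (s n) y) (\<Phi> (s N) y)) \<longlonglongrightarrow> dist (l y) (\<Phi> (s N) y)"
        by (intro tendsto_intros l that)
      show "\<exists>N'. \<forall>n\<ge>N'. dist (\<Phi> (s n) y) (\<Phi> (s N) y) \<le> \<epsilon>/2"
        using N that by (meson less_imp_le order_refl)
    qed
    then show ?thesis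
      using s[of N] \<open>\<epsilon> > 0\<close> by (smt (verit) field_sum_of_halves)
  qed
  then have "restrict l X \<in> ellis"
    by (simp add: ellis_def)
  then show ?thesis
    by (rule bexI[rotated]) (simp add: l)
qed

text \<open>Approximate \<open>f\<close> by \<open>g\<close> at the point \<open>f' y\<close>, then
  \<open>f'\<close> by \<open>g'\<close> so closely that equicontinuity controls the error after
  applying \<open>g\<close>.\<close>

lemma ellis_compose:
  assumes f: "f \<in> ellis" and f': "f' \<in> ellis"
  shows "compose X f f' \<in> ellis"
  unfolding ellis_def
proof (intro CollectI conjI allI impI)
  show "compose X f f' \<in> extensional X"
    by (simp add: compose_def)
next
  fix \<epsilon> :: real assume "\<epsilon> > 0"
  then obtain \<delta> where \<delta>: "\<delta> > 0"
    "\<And>u v g. \<lbrakk>u \<in> X; v \<in> X; g \<in> carrier G; dist u v < \<delta>\<rbrakk> \<Longrightarrow> dist (\<Phi> g u) (\<Phi> g v) < \<epsilon>/2"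
    using equicontinuousE[of "\<epsilon>/2"] by (metis half_gt_zero)
  obtain g where g: "g \<in> carrier G" "\<And>y. y \<in> X \<Longrightarrow> dist (f y) (\<Phi> g y) < \<epsilon>/2"
    using ellisE[OF f, of "\<epsilon>/2"] \<open>\<epsilon> > 0\<close> by (metis half_gt_zero)
  obtain g' where g': "g' \<in> carrier G" "\<And>y. y \<in> X \<Longrightarrow> dist (f' y) (\<Phi> g' y) < \<delta>"
    using ellisE[OF f' \<delta>(1)] by metis
  have "dist (compose X f f' y) (\<Phi> (g \<otimes> g') y) < \<epsilon>" if y: "y \<in> X" for y
  proof -
    have "dist (f (f' y)) (\<Phi> g (f' y)) < \<epsilon>/2"
      using g(2)[OF ellis_closed[OF f' y]] .
    moreover have "dist (\<Phi> g (f' y)) (\<Phi> g (\<Phi> g' y)) < \<epsilon>/2"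
      using \<delta>(2)[OF ellis_closed[OF f' y] action_closed[OF g'(1) y] g(1) g'(2)[OF y]] .
    ultimately have "dist (f (f' y)) (\<Phi> g (\<Phi> g' y)) < \<epsilon>"
      using dist_triangle[of "f (f' y)" "\<Phi> g (\<Phi> g' y)" "\<Phi> g (f' y)"] by linarith
    then show ?thesis
      using y g(1) g'(1) by (simp add: compose_eq composition_rule)
  qed
  then show "\<exists>k\<in>carrier G. \<forall>y\<in>X. dist (compose X f f' y) (\<Phi> k y) < \<epsilon>"
    using g g' by blast
qed

text \<open>If \<open>\<Phi> (s n)\<close> tends uniformly to \<open>f\<close>, equicontinuity makes
  the inverses uniformly Cauchy. Their limit is a right inverse of \<open>f\<close>, and injectivity
  of \<open>f\<close> makes it two-sided.\<close>

lemma ellis_inverse: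
  assumes f: "f \<in> ellis"
  obtains f' where "f' \<in> ellis" "\<And>y. y \<in> X \<Longrightarrow> f (f' y) = y" "\<And>y. y \<in> X \<Longrightarrow> f' (f y) = y"
proof -
  have "\<exists>g\<in>carrier G. \<forall>y\<in>X. dist (f y) (\<Phi> g y) < 1 / Suc n" for n
    using f by (simp add: ellis_def)
  then obtain s where s: "\<And>n. s n \<in> carrier G"
    and sf: "\<And>n y. y \<in> X \<Longrightarrow> dist (f y) (\<Phi> (s n) y) < 1 / Suc n"
    by metis
  have approx: "\<exists>N. \<forall>n\<ge>N. \<forall>y\<in>X. dist (f y) (\<Phi> (s n) y) < \<epsilon>" if \<epsilon>: "\<epsilon> > 0" for \<epsilon>
  proof -
    obtain N where N: "1 / real (Suc N) < \<epsilon>"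
      using nat_approx_posE[OF \<epsilon>] by metis
    have "1 / real (Suc n) \<le> 1 / real (Suc N)" if "n \<ge> N" for n
      using that by (simp add: frac_le)
    then show ?thesis
      using N sf by (meson less_le_trans less_trans)
  qed
  have inv_Cauchy: "\<exists>N. \<forall>m\<ge>N. \<forall>n\<ge>N. \<forall>y\<in>X. dist (\<Phi> (inv s m) y) (\<Phi> (inv s n) y) < \<epsilon>"
    if \<epsilon>: "\<epsilon> > 0" for \<epsilon>
  proof -
    obtain \<delta> where \<delta>: "\<delta> > 0"
      "\<And>u v g. \<lbrakk>u \<in> X; v \<in> X; g \<in> carrier G; dist u v < \<delta>\<rbrakk> \<Longrightarrow> dist (\<Phi> g u) (\<Phi> g v) < \<epsilon>"
      using equicontinuousE[OF \<epsilon>] by metis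
    obtain N where N: "\<And>n y. \<lbrakk>n \<ge> N; y \<in> X\<rbrakk> \<Longrightarrow> dist (f y) (\<Phi> (s n) y) < \<delta>/2"
      using approx[of "\<delta>/2"] \<delta>(1) by auto
    have "dist (\<Phi> (inv s m) y) (\<Phi> (inv s n) y) < \<epsilon>" if "m \<ge> N" "n \<ge> N" "y \<in> X" for m n y
    proof -
      \<comment> \<open>Writing \<open>y\<close> as \<open>\<Phi> (s n) ?z\<close> exhibits both
        points as images under the single element \<open>inv s m\<close> of two
        \<open>\<delta>\<close>-close points.\<close>
      let ?z = "\<Phi> (inv s n) y"
      have z: "?z \<in> X" and zy: "\<Phi> (s n) ?z = y"
        using s that by (auto simp: action_inv_right)
      have "dist (\<Phi> (s n) ?z) (\<Phi> (s m) ?z) < \<delta>"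
        using N[OF that(1) z] N[OF that(2) z] by (metis dist_commute dist_triangle_half_l)
      then have "dist (\<Phi> (inv s m) (\<Phi> (s n) ?z)) (\<Phi> (inv s m) (\<Phi> (s m) ?z)) < \<epsilon>"
        using s z by (intro \<delta>(2)) auto
      then show ?thesis
        using s z zy by (simp add: action_inv_left)
    qed
    then show ?thesis by blast
  qed
  obtain f' where f': "f' \<in> ellis" and lim: "\<And>y. y \<in> X \<Longrightarrow> (\<lambda>n. \<Phi> (inv s n) y) \<longlonglongrightarrow> f' y"
    using uniformly_Cauchy_action_limit[of "\<lambda>n. inv s n", OF inv_closed[OF s] inv_Cauchy]
    by blast
  have right: "f (f' y) = y" if y: "y \<in> X" for y
  proof -
    have "dist (f (f' y)) y < \<epsilon>" if \<epsilon>: "\<epsilon> > 0" for \<epsilon>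
    proof -
      obtain \<delta> where \<delta>: "\<delta> > 0"
        "\<And>u v g. \<lbrakk>u \<in> X; v \<in> X; g \<in> carrier G; dist u v < \<delta>\<rbrakk> \<Longrightarrow> dist (\<Phi> g u) (\<Phi> g v) < \<epsilon>/2"
        using equicontinuousE[of "\<epsilon>/2"] \<epsilon> by (metis half_gt_zero)
      obtain N where N: "\<And>n y. \<lbrakk>n \<ge> N; y \<in> X\<rbrakk> \<Longrightarrow> dist (f y) (\<Phi> (s n) y) < \<epsilon>/2"
        using approx[of "\<epsilon>/2"] \<epsilon> by auto
      obtain M where M: "\<And>n. n \<ge> M \<Longrightarrow> dist (\<Phi> (inv s n) y) (f' y) < \<delta>"
        using lim[OF y] \<delta>(1) unfolding lim_sequentially by metis
      let ?n = "max M N"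
      have "dist (\<Phi> (s ?n) (\<Phi> (inv s ?n) y)) (\<Phi> (s ?n) (f' y)) < \<epsilon>/2"
        using M[of ?n] s y f' by (intro \<delta>(2)) (auto simp: ellis_closed)
      moreover have "dist (f (f' y)) (\<Phi> (s ?n) (f' y)) < \<epsilon>/2"
        using f' y by (intro N) (auto simp: ellis_closed)
      ultimately show ?thesis
        using s y by (metis action_inv_right dist_commute dist_triangle_half_l)
    qed
    then show ?thesis
      by (metis dist_pos_lt less_irrefl)
  qed
  \<comment> \<open>If \<open>f\<close> identified \<open>u\<close> and \<open>v\<close>, some
    \<open>g\<close> would bring them within \<open>\<delta>\<close>, and then \<open>inv g\<close>
    would return them at distance less than \<open>dist u v\<close>.\<close>
  have inj: "u = v" if uv: "u \<in> X" "v \<in> X" "f u = f v" for u v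
  proof (rule ccontr)
    assume "u \<noteq> v"
    then obtain \<delta> where \<delta>: "\<delta> > 0"
      "\<And>p q g. \<lbrakk>p \<in> X; q \<in> X; g \<in> carrier G; dist p q < \<delta>\<rbrakk> \<Longrightarrow> dist (\<Phi> g p) (\<Phi> g q) < dist u v"
      using equicontinuousE[of "dist u v"] by (metis zero_less_dist_iff)
    obtain g where g: "g \<in> carrier G" "\<And>y. y \<in> X \<Longrightarrow> dist (f y) (\<Phi> g y) < \<delta>/2"
      using ellisE[OF f, of "\<delta>/2"] \<delta>(1) by (metis half_gt_zero)
    have "dist (\<Phi> g u) (\<Phi> g v) < \<delta>"
      using g(2)[OF uv(1)] g(2)[OF uv(2)] uv(3) by (metis dist_commute dist_triangle_half_l)
    then have "dist (\<Phi> (inv g) (\<Phi> g u)) (\<Phi> (inv g) (\<Phi> g v)) < dist u v"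
      using g uv by (intro \<delta>(2)) auto
    then show False
      using g uv by (simp add: action_inv_left)
  qed
  have "f' (f y) = y" if "y \<in> X" for y
    by (rule inj) (use that right f f' in \<open>auto simp: ellis_closed\<close>)
  then show thesis
    using that f' right by blast
qed

text \<open>Conjugation by \<open>h\<close> is the bijection; \<open>compose X\<close> keeps the
  conjugates extensional.\<close>

lemma ellis_isotropy_conjugate:
  assumes h: "h \<in> ellis" and x: "x \<in> X" and y: "y \<in> X" and hx: "h x = y"
  shows "{f \<in> ellis. f x = x} \<approx> {f \<in> ellis. f y = y}"
proof -
  obtain h' where h': "h' \<in> ellis" "\<And>y. y \<in> X \<Longrightarrow> h (h' y) = y" "\<And>y. y \<in> X \<Longrightarrow> h' (h y) = y"
    using ellis_inverse[OF h] by metis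
  have hy: "h' y = x"
    using h'(3) x hx by blast
  let ?c = "\<lambda>f. compose X h (compose X f h')"
  let ?d = "\<lambda>f. compose X h' (compose X f h)"
  have "bij_betw ?c {f \<in> ellis. f x = x} {f \<in> ellis. f y = y}"
  proof (rule bij_betw_byWitness[where f' = ?d])
    show "\<forall>f\<in>{f \<in> ellis. f x = x}. ?d (?c f) = f"
      using h h' by (auto intro!: extensionalityI[where A = X]
        simp: compose_eq ellis_closed ellis_extensional)
    show "\<forall>f\<in>{f \<in> ellis. f y = y}. ?c (?d f) = f"
      using h h' by (auto intro!: extensionalityI[where A = X]
        simp: compose_eq ellis_closed ellis_extensional)
    show "?c ` {f \<in> ellis. f x = x} \<subseteq> {f \<in> ellis. f y = y}"
      using h h' y hx hy by (auto simp: compose_eq intro!: ellis_compose)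
    show "?d ` {f \<in> ellis. f y = y} \<subseteq> {f \<in> ellis. f x = x}"
      using h h' x hx hy by (auto simp: compose_eq intro!: ellis_compose)
  qed
  then show ?thesis
    unfolding eqpoll_def by blast
qed

end

section \<open>Shrinking partitions into translates and the permutations induced on them\<close>

locale partition_chain = equicontinuous_compact_action G X \<Phi>
  for G :: "('g, 'm) monoid_scheme" (structure)
    and X :: "'a::metric_space set"
    and \<Phi> :: "'g \<Rightarrow> 'a \<Rightarrow> 'a" +
  fixes x :: 'a and V :: "nat \<Rightarrow> 'a set" and P :: "nat \<Rightarrow> 'a set set"
  assumes V_decreasing: "V (Suc i) \<subseteq> V i"
    and V_openin: "openin (top_of_set X) (V i)"
    and V_Inter: "(\<Inter>i. V i) = {x}"
    and P_translates: "P i = {\<Phi> g ` V i | g. g \<in> carrier G}"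
    and finite_P: "finite (P i)"
    and partition_P: "partition_on X (P i)"
    and diameter_P: "i \<ge> 1 \<Longrightarrow> g \<in> carrier G \<Longrightarrow> diameter (\<Phi> g ` V i) < 1 / 2 ^ i"
begin

lemma x_in_V: "x \<in> V i"
  using V_Inter by blast

lemma V_subset: "V i \<subseteq> X"
  using V_openin openin_imp_subset by blast

lemma x_in_X: "x \<in> X"
  using x_in_V V_subset by blast

lemma translate_in_P [intro]: "g \<in> carrier G \<Longrightarrow> \<Phi> g ` V i \<in> P i"
  using P_translates by blast

lemma P_subset: "A \<in> P i \<Longrightarrow> A \<subseteq> X"
  using partition_P partition_onD1 by blast

lemma V_in_P: "V i \<in> P i"
proof -
  have "\<Phi> \<one> ` V i = V i"
    using V_subset[of i] by (force simp: id_eq_one[symmetric])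
  then show ?thesis
    using translate_in_P[OF one_closed, of i] by simp
qed

lemma image_in_P [intro]:
  assumes g: "g \<in> carrier G" and A: "A \<in> P i"
  shows "\<Phi> g ` A \<in> P i"
proof -
  obtain k where k: "k \<in> carrier G" "A = \<Phi> k ` V i"
    using A by (auto simp: P_translates)
  then have "\<Phi> g ` A = \<Phi> (g \<otimes> k) ` V i"
    using image_mult[OF g k(1) V_subset] by simp
  then show ?thesis
    using g k by auto
qed

lemma P_eqI: "\<lbrakk>A \<in> P i; B \<in> P i; z \<in> A; z \<in> B\<rbrakk> \<Longrightarrow> A = B"
  using partition_onD2[OF partition_P] by (meson disjointD disjoint_iff)

lemma P_nonempty: "A \<in> P i \<Longrightarrow> A \<noteq> {}"
  using partition_onD3[OF partition_P] by blast

lemma P_cover: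
  assumes "y \<in> X"
  obtains A where "A \<in> P i" "y \<in> A"
  using partition_onD1[OF partition_P] assms by blast

lemma P_openin: "A \<in> P i \<Longrightarrow> openin (top_of_set X) A"
  using action V_openin homeomorphism_imp_open_map
  by (fastforce simp: P_translates action_by_homeomorphisms_def)

text \<open>A cell is the complement in \<open>X\<close> of the union of the other cells, all of
  them open. Closedness keeps limits of points of a cell inside it.\<close>

lemma P_closed:
  assumes A: "A \<in> P i"
  shows "closed A"
proof -
  have "A = X - \<Union>(P i - {A})"
  proof (intro equalityI subsetI DiffI notI)
    fix y assume "y \<in> A" "y \<in> \<Union>(P i - {A})"
    then show False
      using P_eqI[OF A] by blast
  next
    fix y assume "y \<in> X - \<Union>(P i - {A})"
    then show "y \<in> A"
      using P_cover[of y i] by blast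
  qed (use P_subset[OF A] in blast)
  moreover have "openin (top_of_set X) (\<Union>(P i - {A}))"
    using P_openin by blast
  ultimately have "closedin (top_of_set X) A"
    by (metis closedin_diff closedin_topspace topspace_euclidean_subtopology)
  then show ?thesis
    using compact_X closedin_closed_trans compact_imp_closed by blast
qed

text \<open>The finer cell at \<open>y\<close> is a translate of \<open>V (Suc i)\<close>. The same
  translate of \<open>V i\<close> contains it, hence meets \<open>A\<close> and must be
  \<open>A\<close>.\<close>

lemma P_refines:
  assumes A: "A \<in> P i" and y: "y \<in> A"
  obtains B where "B \<in> P (Suc i)" "y \<in> B" "B \<subseteq> A"
proof -
  obtain B where B: "B \<in> P (Suc i)" "y \<in> B"
    using P_cover[OF subsetD[OF P_subset[OF A] y]] .
  then obtain g where g: "g \<in> carrier G" "B = \<Phi> g ` V (Suc i)"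
    by (auto simp: P_translates)
  then have "B \<subseteq> \<Phi> g ` V i"
    using V_decreasing by blast
  moreover have "\<Phi> g ` V i = A"
    using calculation B(2) A y g(1) by (meson P_eqI subsetD translate_in_P)
  ultimately show thesis
    using that B by blast
qed

lemma P_small:
  assumes A: "A \<in> P (Suc i)" and "u \<in> A" "v \<in> A"
  shows "dist u v < 1 / 2 ^ Suc i"
proof -
  \<comment> \<open>\<open>diameter\<close> is a supremum, so boundedness must be known before it
    bounds distances.\<close>
  have "bounded A"
    using P_subset[OF A] compact_X compact_imp_bounded bounded_subset by blast
  then have "dist u v \<le> diameter A"
    using assms diameter_bounded_bound by blast
  also have "\<dots> < 1 / 2 ^ Suc i"
    using A diameter_P[of "Suc i"] by (auto simp: P_translates)
  finally show ?thesis .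
qed

text \<open>For \<open>f\<close> in the closure of the action, this is the set of group elements inducing the same
  permutation of \<open>P i\<close> as \<open>f\<close>. Inclusion suffices, since distinct cells are disjoint, and it
  spares us the surjectivity of \<open>f\<close>.\<close>

definition agreeing :: "nat \<Rightarrow> ('a \<Rightarrow> 'a) \<Rightarrow> 'g set" where
  "agreeing i f = {k \<in> carrier G. \<forall>A\<in>P i. f ` A \<subseteq> \<Phi> k ` A}"

text \<open>Both images are nonempty cells, so inclusion between them already forces
  equality.\<close>

lemma agreeing_translate:
  assumes "g \<in> carrier G"
  shows "agreeing i (\<Phi> g) = {k \<in> carrier G. \<forall>A\<in>P i. \<Phi> k ` A = \<Phi> g ` A}"
proof -
  have "\<Phi> k ` A = \<Phi> g ` A" if "k \<in> carrier G" "A \<in> P i" "\<Phi> g ` A \<subseteq> \<Phi> k ` A" for k A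
    using that assms P_nonempty[OF that(2)] by (metis P_eqI ex_in_conv image_in_P image_is_empty subsetD)
  then have "(\<forall>A\<in>P i. \<Phi> g ` A \<subseteq> \<Phi> k ` A) \<longleftrightarrow> (\<forall>A\<in>P i. \<Phi> k ` A = \<Phi> g ` A)"
    if "k \<in> carrier G" for k
    using that by (metis order_refl)
  then show ?thesis
    unfolding agreeing_def by (intro Collect_cong conj_cong refl)
qed

lemma agreeing_self: "g \<in> carrier G \<Longrightarrow> g \<in> agreeing i (\<Phi> g)"
  by (simp add: agreeing_def)

text \<open>Every point of a cell lies in a finer cell inside it, so behaviour on the finer
  partition determines behaviour on the coarser one.\<close>

lemma agreeing_Suc:
  assumes f: "\<And>y. y \<in> X \<Longrightarrow> f y \<in> X"
  shows "agreeing (Suc i) f \<subseteq> agreeing i f"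
  unfolding agreeing_def
proof safe
  fix k A y
  assume k: "k \<in> carrier G" "\<forall>A\<in>P (Suc i). f ` A \<subseteq> \<Phi> k ` A" and A: "A \<in> P i" "y \<in> A"
  obtain B where "B \<in> P (Suc i)" "y \<in> B" "B \<subseteq> A"
    using P_refines[OF A] .
  then show "f y \<in> \<Phi> k ` A"
    using k by blast
qed

text \<open>Two elements agreeing with \<open>f\<close> send a cell to cells that share a value of
  \<open>f\<close>, hence to the same cell. So at level \<open>i\<close> any agreeing element may
  replace \<open>f\<close>.\<close>

lemma agreeing_eq:
  assumes "g \<in> agreeing i f"
  shows "agreeing i f = agreeing i (\<Phi> g)"
proof -
  have g: "g \<in> carrier G" and fg: "\<And>A. A \<in> P i \<Longrightarrow> f ` A \<subseteq> \<Phi> g ` A"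
    using assms by (auto simp: agreeing_def)
  have "\<Phi> k ` A = \<Phi> g ` A" if k: "k \<in> agreeing i f" "A \<in> P i" for k A
  proof -
    obtain y where "y \<in> A"
      using P_nonempty[OF k(2)] by blast
    then have "f y \<in> \<Phi> k ` A" "f y \<in> \<Phi> g ` A"
      using k fg[OF k(2)] unfolding agreeing_def by blast+
    moreover have "\<Phi> k ` A \<in> P i" "\<Phi> g ` A \<in> P i"
      using k g by (auto simp: agreeing_def)
    ultimately show ?thesis
      using P_eqI by blast
  qed
  then show ?thesis
    using fg unfolding agreeing_translate[OF g]
    by (intro equalityI subsetI) (simp_all add: agreeing_def)
qed

text \<open>An element uniformly closer to \<open>f\<close> than a Lebesgue number of the open cover
  \<open>P i\<close> sends every point to the same cell as \<open>f\<close> does.\<close>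

lemma agreeing_ellis_nonempty:
  assumes f: "f \<in> ellis"
  shows "agreeing i f \<noteq> {}"
proof -
  \<comment> \<open>\<open>e\<close> is the Lebesgue number; the cover consists of ambient open sets
    whose traces on \<open>X\<close> are the cells.\<close>
  obtain e where e: "e > 0" "\<And>u. u \<in> X \<Longrightarrow> \<exists>U\<in>{U. open U \<and> X \<inter> U \<in> P i}. ball u e \<subseteq> U"
  proof (rule Heine_Borel_lemma[OF compact_X])
    show "X \<subseteq> \<Union>{U. open U \<and> X \<inter> U \<in> P i}"
    proof
      fix y assume "y \<in> X"
      then obtain A where A: "A \<in> P i" "y \<in> A"
        by (rule P_cover)
      then obtain U where "open U" "A = X \<inter> U"
        using P_openin openin_open by metis
      then show "y \<in> \<Union>{U. open U \<and> X \<inter> U \<in> P i}"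
        using A by blast
    qed
  qed auto
  obtain g where g: "g \<in> carrier G" "\<And>y. y \<in> X \<Longrightarrow> dist (f y) (\<Phi> g y) < e"
    using ellisE[OF f e(1)] by metis
  have "f y \<in> \<Phi> g ` A" if A: "A \<in> P i" "y \<in> A" for A y
  proof -
    have y: "y \<in> X"
      using A P_subset by blast
    obtain U where U: "X \<inter> U \<in> P i" "ball (f y) e \<subseteq> U"
      using e(2) ellis_closed[OF f y] by blast
    have "\<Phi> g y \<in> X \<inter> U" "f y \<in> X \<inter> U"
      using U g y e(1) ellis_closed[OF f y] by auto
    then show ?thesis
      using P_eqI[OF U(1) image_in_P[OF g(1) A(1)]] A(2) by blast
  qed
  then show ?thesis
    using g by (auto simp: agreeing_def)
qed

text \<open>From index \<open>Suc N\<close> on, all \<open>s n\<close> send a given point into one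
  cell of \<open>P (Suc N)\<close>, so smallness of cells gives the uniform Cauchy property. As
  cells are closed, the limit stays in the prescribed ones.\<close>

lemma agreeing_sequence_limit:
  assumes s: "\<And>n. s n \<in> carrier G"
    and agree: "\<And>i j. i \<le> j \<Longrightarrow> s j \<in> agreeing i (\<Phi> (s i))"
  shows "\<exists>f\<in>ellis. (\<forall>y\<in>X. (\<lambda>n. \<Phi> (s n) y) \<longlonglongrightarrow> f y) \<and> (\<forall>i. s i \<in> agreeing i f)"
proof -
  have same: "\<Phi> (s j) ` A = \<Phi> (s i) ` A" if "i \<le> j" "A \<in> P i" for i j A
    using agree[OF that(1)] that(2) by (simp add: agreeing_translate s)
  have Cauchy: "\<exists>N. \<forall>m\<ge>N. \<forall>n\<ge>N. \<forall>y\<in>X. dist (\<Phi> (s m) y) (\<Phi> (s n) y) < \<epsilon>" if \<epsilon>: "\<epsilon> > 0" for \<epsilon>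
  proof -
    obtain N where N: "(1/2::real) ^ N < \<epsilon>"
      using real_arch_pow_inv[OF \<epsilon>, of "1/2"] by auto
    have "dist (\<Phi> (s m) y) (\<Phi> (s n) y) < \<epsilon>"
      if m: "m \<ge> Suc N" and n: "n \<ge> Suc N" and y: "y \<in> X" for m n y
    proof -
      obtain A where A: "A \<in> P (Suc N)" "y \<in> A"
        using P_cover[OF y] .
      have "dist (\<Phi> (s m) y) (\<Phi> (s n) y) < 1 / 2 ^ Suc N"
        using same[OF m A(1)] same[OF n A(1)] A s
        by (intro P_small[OF image_in_P[OF s[of "Suc N"] A(1)]]) blast+
      also have "\<dots> \<le> (1/2) ^ N"
        by (simp add: power_one_over field_simps)
      finally show ?thesis
        using N by simp
    qed
    then show ?thesis by blast
  qed
  obtain f where f: "f \<in> ellis" "\<And>y. y \<in> X \<Longrightarrow> (\<lambda>n. \<Phi> (s n) y) \<longlonglongrightarrow> f y"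
    using uniformly_Cauchy_action_limit[of s, OF s Cauchy] by blast
  have "f y \<in> \<Phi> (s i) ` A" if A: "A \<in> P i" "y \<in> A" for i A y
  proof (rule Lim_in_closed_set)
    show "closed (\<Phi> (s i) ` A)"
      using P_closed[OF image_in_P[OF s A(1)]] .
    show "\<forall>\<^sub>F n in sequentially. \<Phi> (s n) y \<in> \<Phi> (s i) ` A"
    proof (rule eventually_sequentiallyI)
      show "\<Phi> (s n) y \<in> \<Phi> (s i) ` A" if "i \<le> n" for n
        using same[OF that A(1)] A(2) by blast
    qed
    show "(\<lambda>n. \<Phi> (s n) y) \<longlonglongrightarrow> f y"
      using A P_subset f(2) by blast
  qed simp
  then have "s i \<in> agreeing i f" for i
    using s by (auto simp: agreeing_def)
  then show ?thesis
    using f by blast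
qed

text \<open>Minimality yields elements moving \<open>x\<close> ever closer to \<open>y\<close>. Each
  partition has finitely many permutations, so a diagonal choice gives a sequence whose induced
  permutations stabilize at every level; its limit maps \<open>x\<close> to
  \<open>y\<close>.\<close>

lemma ellis_transitive:
  assumes minimal: "minimal_action G X \<Phi>" and y: "y \<in> X"
  obtains h where "h \<in> ellis" "h x = y"
proof -
  have "\<exists>g\<in>carrier G. dist (\<Phi> g x) y < 1 / Suc n" for n
  proof -
    have "y \<in> closure (orbit G \<Phi> x)"
      using minimal x_in_X y by (auto simp: minimal_action_def)
    then have "\<exists>z\<in>orbit G \<Phi> x. dist z y < 1 / Suc n"
      by (simp add: closure_approachable)
    then show ?thesis
      by (auto simp: orbit_def)
  qed
  then obtain g where g: "\<And>n. g n \<in> carrier G" and gx: "\<And>n. dist (\<Phi> (g n) x) y < 1 / Suc n"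
    by metis
  have pigeonhole: "\<exists>T'. infinite T' \<and> T' \<subseteq> T \<and> (\<forall>m\<in>T'. \<forall>n\<in>T'. g m \<in> agreeing i (\<Phi> (g n)))"
    if T: "infinite T" for T i
  proof -
    \<comment> \<open>Restricting to \<open>P i\<close> places the induced permutations in the
      finite set \<open>P i \<rightarrow>\<^sub>E P i\<close>.\<close>
    let ?perm = "\<lambda>n. \<lambda>A\<in>P i. \<Phi> (g n) ` A"
    have "?perm ` T \<subseteq> P i \<rightarrow>\<^sub>E P i"
      using image_in_P[OF g] by (auto intro!: restrict_PiE_iff[THEN iffD2])
    then have "finite (?perm ` T)"
      using finite_P finite_PiE finite_subset by metis
    then obtain a where a: "infinite {n \<in> T. ?perm n = ?perm a}"
      using pigeonhole_infinite[OF T] by blast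
    have "g m \<in> agreeing i (\<Phi> (g n))" if "?perm m = ?perm a" "?perm n = ?perm a" for m n
    proof -
      have "?perm m A = ?perm n A" for A
        using that by metis
      then have "\<forall>A\<in>P i. \<Phi> (g m) ` A = \<Phi> (g n) ` A"
        by (metis restrict_apply')
      then show ?thesis
        using g by (simp add: agreeing_translate)
    qed
    with a show ?thesis
      by (intro exI[of _ "{n \<in> T. ?perm n = ?perm a}"]) auto
  qed
  define Q where "Q i T \<longleftrightarrow> infinite T \<and> (\<forall>m\<in>T. \<forall>n\<in>T. g m \<in> agreeing i (\<Phi> (g n)))" for i T
  have "\<exists>T. \<forall>i. Q i (T i) \<and> T (Suc i) \<subseteq> T i"
  proof (rule dependent_nat_choice)
    show "\<exists>T. Q 0 T"
      using pigeonhole[of UNIV 0] by (auto simp: Q_def)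
    show "\<exists>T'. Q (Suc i) T' \<and> T' \<subseteq> T" if "Q i T" for T i
      using pigeonhole[of T "Suc i"] that unfolding Q_def by blast
  qed
  then obtain T where Q: "\<And>i. Q i (T i)" and decr: "\<And>i. T (Suc i) \<subseteq> T i"
    by blast
  have inf: "infinite (T i)" for i
    using Q unfolding Q_def by blast
  have T: "g m \<in> agreeing i (\<Phi> (g n))" if "m \<in> T i" "n \<in> T i" for i m n
    using Q that unfolding Q_def by blast
  \<comment> \<open>Diagonal choice: \<open>r\<close> need not be increasing, since
    \<open>i \<le> r i\<close> already gives the distance bound \<open>1 / Suc i\<close>.\<close>
  have "\<exists>n\<in>T i. i \<le> n" for i
    using inf[of i] by (meson infinite_nat_iff_unbounded_le)
  then obtain r where r: "\<And>i. r i \<in> T i" and ri: "\<And>i. i \<le> r i"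
    by metis
  have mono: "T j \<subseteq> T i" if "i \<le> j" for i j
    using lift_Suc_antimono_le[of T, OF decr that] .
  obtain h where h: "h \<in> ellis" and lim: "\<And>y. y \<in> X \<Longrightarrow> (\<lambda>n. \<Phi> (g (r n)) y) \<longlonglongrightarrow> h y"
    using agreeing_sequence_limit[of "\<lambda>n. g (r n)", OF g T[OF subsetD[OF mono r] r]]
    by blast
  have "(\<lambda>n. \<Phi> (g (r n)) x) \<longlonglongrightarrow> y"
  proof (rule metric_tendsto_imp_tendsto)
    show "(\<lambda>n. 1 / real (Suc n)) \<longlonglongrightarrow> 0"
      by (rule LIMSEQ_Suc[OF lim_1_over_n])
    have "dist (\<Phi> (g (r n)) x) y \<le> 1 / real (Suc n)" for n
    proof -
      have "1 / real (Suc (r n)) \<le> 1 / real (Suc n)"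
        using ri[of n] by (simp add: frac_le)
      then show ?thesis
        using gx[of "r n"] by linarith
    qed
    then show "\<forall>\<^sub>F n in sequentially. dist (\<Phi> (g (r n)) x) y \<le> dist (1 / real (Suc n)) 0"
      by (simp add: dist_real_def)
  qed
  then have "h x = y"
    using lim[OF x_in_X] LIMSEQ_unique by blast
  with h that show thesis by blast
qed

section \<open>Cores, coset spaces and the discriminant group\<close>

abbreviation isotropy :: "nat \<Rightarrow> 'g set" where
  "isotropy i \<equiv> stabilizer G (\<lambda>g. image (\<Phi> g)) (V i)"

text \<open>\<open>V i\<close> is the cell of \<open>x\<close>, so a translate of it equals
  \<open>V i\<close> as soon as it carries \<open>x\<close> into \<open>V i\<close>.\<close>

lemma isotropy_iff:
  assumes "g \<in> carrier G"
  shows "g \<in> isotropy i \<longleftrightarrow> \<Phi> g x \<in> V i"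
  using assms P_eqI[OF translate_in_P[OF assms] V_in_P, of "\<Phi> g x" i] x_in_V
  by (auto simp: stabilizer_def)

text \<open>The conjugate of the stabilizer by \<open>g\<close> stabilizes the translate of
  \<open>V i\<close> by \<open>g\<close>. Translates exhaust \<open>P i\<close>, so the core is the
  kernel of the action on \<open>P i\<close>.\<close>

lemma normal_core_isotropy:
  "normal_core G (isotropy i) = {c \<in> carrier G. \<forall>A\<in>P i. \<Phi> c ` A = A}"
proof -
  have conj: "c \<in> g <# isotropy i #> inv g \<longleftrightarrow> \<Phi> c ` \<Phi> g ` V i = \<Phi> g ` V i"
    if g: "g \<in> carrier G" and c: "c \<in> carrier G" for c g
  proof -
    have "c = g \<otimes> s \<otimes> inv g \<longleftrightarrow> s = inv g \<otimes> (c \<otimes> g)" if "s \<in> carrier G" for s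
      using g c that by (metis inv_closed inv_solve_left inv_solve_right m_assoc m_closed)
    then have "c \<in> g <# isotropy i #> inv g \<longleftrightarrow> inv g \<otimes> (c \<otimes> g) \<in> isotropy i"
      using g c by (auto simp: l_coset_def r_coset_def stabilizer_def)
    also have "\<dots> \<longleftrightarrow> \<Phi> (inv g) ` \<Phi> c ` \<Phi> g ` V i = V i"
      using g c V_subset[of i] P_subset[OF translate_in_P[OF g, of i]]
        P_subset[OF image_in_P[OF c translate_in_P[OF g, of i]]]
      by (simp add: stabilizer_def image_mult P_subset)
    also have "\<dots> \<longleftrightarrow> \<Phi> c ` \<Phi> g ` V i = \<Phi> g ` V i"
      using image_inv_eq_iff[OF g P_subset[OF image_in_P[OF c translate_in_P[OF g]]] V_subset] .
    finally show ?thesis .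
  qed
  have "normal_core G (isotropy i) \<subseteq> \<one> <# isotropy i #> inv \<one>"
    unfolding normal_core_def by blast
  also have "\<dots> \<subseteq> carrier G"
    by (auto simp: l_coset_def r_coset_def stabilizer_def)
  finally have "normal_core G (isotropy i) \<subseteq> carrier G" .
  moreover have "c \<in> normal_core G (isotropy i) \<longleftrightarrow> (\<forall>A\<in>P i. \<Phi> c ` A = A)" if "c \<in> carrier G" for c
  proof -
    have "c \<in> normal_core G (isotropy i) \<longleftrightarrow> (\<forall>g\<in>carrier G. \<Phi> c ` \<Phi> g ` V i = \<Phi> g ` V i)"
      using conj[OF _ that] by (simp add: normal_core_def)
    then show ?thesis
      unfolding P_translates by blast
  qed
  ultimately show ?thesis
    by blast
qed

text \<open>Cosets of that kernel are the classes of elements inducing equal permutations of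
  \<open>P i\<close>: if \<open>k\<close> and \<open>g\<close> do, then
  \<open>k \<otimes> inv g\<close> fixes every cell.\<close>

lemma carrier_chain_quotient:
  "carrier (chain_quotient G isotropy i) = (\<lambda>g. agreeing i (\<Phi> g)) ` isotropy i"
proof -
  have "normal_core G (isotropy i) #> g = agreeing i (\<Phi> g)" if g: "g \<in> carrier G" for g
  proof (intro equalityI subsetI)
    fix k assume "k \<in> normal_core G (isotropy i) #> g"
    then obtain c where "c \<in> carrier G" "\<forall>A\<in>P i. \<Phi> c ` A = A" "k = c \<otimes> g"
      by (auto simp: normal_core_isotropy r_coset_def)
    then show "k \<in> agreeing i (\<Phi> g)"
      using g image_in_P[OF g] by (simp add: agreeing_translate image_mult P_subset)
  next
    fix k assume "k \<in> agreeing i (\<Phi> g)"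
    then have k: "k \<in> carrier G" "\<And>A. A \<in> P i \<Longrightarrow> \<Phi> k ` A = \<Phi> g ` A"
      by (auto simp: agreeing_translate g)
    have "\<Phi> (k \<otimes> inv g) ` A = A" if A: "A \<in> P i" for A
    proof -
      have B: "\<Phi> (inv g) ` A \<in> P i"
        using g A by blast
      have "\<Phi> (k \<otimes> inv g) ` A = \<Phi> g ` \<Phi> (inv g) ` A"
        using k(1) k(2)[OF B] g P_subset[OF A] by (simp add: image_mult)
      also have "\<dots> = A"
        using image_inv_eq_iff[OF g P_subset[OF A] P_subset[OF B]] by simp
      finally show ?thesis .
    qed
    then have "k \<otimes> inv g \<in> normal_core G (isotropy i)"
      using k(1) g by (simp add: normal_core_isotropy)
    moreover have "k = k \<otimes> inv g \<otimes> g"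
      using k(1) g by (simp add: m_assoc)
    ultimately show "k \<in> normal_core G (isotropy i) #> g"
      unfolding r_coset_def by blast
  qed
  moreover have "isotropy i \<subseteq> carrier G"
    by (auto simp: stabilizer_def)
  ultimately show ?thesis
    unfolding chain_quotient_def carrier_FactGroup
    by (auto simp: r_coset_def intro!: image_cong)
qed

text \<open>Any coset containing the finer class contains \<open>g\<close>, and by
  \<open>agreeing_eq\<close> it is then the class of \<open>g\<close>; this settles the definite
  description.\<close>

lemma bonding_map_agreeing:
  assumes g: "g \<in> isotropy (Suc i)"
  shows "bonding_map G isotropy i (agreeing (Suc i) (\<Phi> g)) = agreeing i (\<Phi> g)"
  unfolding bonding_map_def
proof (rule the_equality)
  have gG: "g \<in> carrier G"
    using g by (simp add: stabilizer_def)
  then have "g \<in> isotropy i"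
    using g V_decreasing by (auto simp: isotropy_iff)
  then show "agreeing i (\<Phi> g) \<in> carrier (chain_quotient G isotropy i) \<and>
      agreeing (Suc i) (\<Phi> g) \<subseteq> agreeing i (\<Phi> g)"
    using gG by (simp add: carrier_chain_quotient agreeing_Suc)
  fix B assume "B \<in> carrier (chain_quotient G isotropy i) \<and> agreeing (Suc i) (\<Phi> g) \<subseteq> B"
  then obtain k where "B = agreeing i (\<Phi> k)" "g \<in> B"
    using agreeing_self[OF gG] by (auto simp: carrier_chain_quotient)
  then show "B = agreeing i (\<Phi> g)"
    using agreeing_eq by blast
qed

text \<open>Compatibility with the bonding maps becomes plain nesting of cosets, the form in which
  representatives can be compared across levels.\<close>

lemma carrier_discriminant_group:
  "s \<in> carrier (discriminant_group G isotropy) \<longleftrightarrow>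
    (\<forall>i. \<exists>g\<in>isotropy i. s i = agreeing i (\<Phi> g)) \<and> (\<forall>i. s (Suc i) \<subseteq> s i)"
proof -
  have "bonding_map G isotropy i (s (Suc i)) = s i \<longleftrightarrow> s (Suc i) \<subseteq> s i"
    if s: "\<forall>i. \<exists>g\<in>isotropy i. s i = agreeing i (\<Phi> g)" for i
  proof -
    obtain g where g: "g \<in> isotropy (Suc i)" "s (Suc i) = agreeing (Suc i) (\<Phi> g)"
      using s by blast
    then have gG: "g \<in> carrier G"
      by (simp add: stabilizer_def)
    obtain k where k: "s i = agreeing i (\<Phi> k)"
      using s by blast
    have "agreeing (Suc i) (\<Phi> g) \<subseteq> agreeing i (\<Phi> k) \<longleftrightarrow> agreeing i (\<Phi> g) = agreeing i (\<Phi> k)"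
      using agreeing_self[OF gG, of "Suc i"] agreeing_eq[of g i "\<Phi> k"]
        agreeing_Suc[of "\<Phi> g" i] gG action_closed by blast
    then show ?thesis
      using g k by (simp add: bonding_map_agreeing)
  qed
  then show ?thesis
    unfolding discriminant_group_def inverse_limit_def
    by (simp add: carrier_chain_quotient image_iff) blast
qed

text \<open>The bijection sends \<open>f\<close> to its sequence of agreeing classes. It is
  injective because two maps with equal classes send each point into common cells of every level,
  and surjective because representatives of nested cosets converge.\<close>

lemma discriminant_group_eqpoll_ellis_isotropy:
  "{f \<in> ellis. f x = x} \<approx> carrier (discriminant_group G isotropy)"
proof -
  have "inj_on (\<lambda>f i. agreeing i f) {f \<in> ellis. f x = x}"
  proof (intro inj_onI)
    fix f f' assume ff': "f \<in> {f \<in> ellis. f x = x}" "f' \<in> {f \<in> ellis. f x = x}"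
      and eq: "(\<lambda>i. agreeing i f) = (\<lambda>i. agreeing i f')"
    show "f = f'"
    proof (rule extensionalityI[where A = X])
      fix y assume y: "y \<in> X"
      have less: "dist (f y) (f' y) < 1 / 2 ^ Suc i" for i
      proof -
        obtain k where k: "k \<in> agreeing (Suc i) f" "k \<in> agreeing (Suc i) f'"
          using agreeing_ellis_nonempty[of f "Suc i"] ff' eq by (auto dest: fun_cong)
        obtain A where A: "A \<in> P (Suc i)" "y \<in> A"
          using P_cover[OF y] .
        then show ?thesis
          using k unfolding agreeing_def by (intro P_small[of "\<Phi> k ` A"]) blast+
      qed
      show "f y = f' y"
      proof (rule ccontr)
        assume "f y \<noteq> f' y"
        then obtain n where n: "(1/2) ^ n < dist (f y) (f' y)"
          using real_arch_pow_inv[of "dist (f y) (f' y)" "1/2"] by auto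
        have "1 / 2 ^ Suc n \<le> (1/2 :: real) ^ n"
          by (simp add: power_one_over field_simps)
        then show False
          using n less[of n] by linarith
      qed
    qed (use ff' ellis_extensional in auto)
  qed
  moreover have "(\<lambda>f i. agreeing i f) ` {f \<in> ellis. f x = x} = carrier (discriminant_group G isotropy)"
  proof (intro equalityI subsetI)
    fix s assume "s \<in> (\<lambda>f i. agreeing i f) ` {f \<in> ellis. f x = x}"
    then obtain f where f: "f \<in> ellis" "f x = x" and s: "s = (\<lambda>i. agreeing i f)"
      by blast
    have "\<exists>g\<in>isotropy i. agreeing i f = agreeing i (\<Phi> g)" for i
    proof -
      obtain g where g: "g \<in> agreeing i f"
        using agreeing_ellis_nonempty[OF f(1)] by blast
      \<comment> \<open>Since \<open>f\<close> fixes \<open>x\<close>, the translate of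
        \<open>V i\<close> by \<open>g\<close> contains \<open>x\<close> and is therefore
        \<open>V i\<close>.\<close>
      then have "g \<in> carrier G" "x \<in> \<Phi> g ` V i"
        using f(2) V_in_P x_in_V[of i] by (force simp: agreeing_def)+
      then have "g \<in> isotropy i"
        using P_eqI[OF translate_in_P V_in_P _ x_in_V] by (simp add: stabilizer_def)
      then show ?thesis
        using agreeing_eq[OF g] by blast
    qed
    then show "s \<in> carrier (discriminant_group G isotropy)"
      using agreeing_Suc f(1) by (simp add: s carrier_discriminant_group ellis_closed)
  next
    fix s assume "s \<in> carrier (discriminant_group G isotropy)"
    then obtain g where g: "\<And>i. g i \<in> isotropy i" and s: "\<And>i. s i = agreeing i (\<Phi> (g i))"
      and decr: "\<And>i. s (Suc i) \<subseteq> s i"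
      unfolding carrier_discriminant_group by metis
    have gG: "g i \<in> carrier G" for i
      using g by (simp add: stabilizer_def)
    have "g j \<in> agreeing i (\<Phi> (g i))" if "i \<le> j" for i j
      using lift_Suc_antimono_le[of s, OF decr that] agreeing_self[OF gG] s by blast
    then obtain f where f: "f \<in> ellis" "\<And>i. g i \<in> agreeing i f"
      using agreeing_sequence_limit[of g, OF gG] by blast
    \<comment> \<open>The cosets lie in the stabilizers, so \<open>f\<close> maps each
      \<open>V i\<close> into itself; the intersection of these sets leaves only
      \<open>x\<close>.\<close>
    have "f x \<in> V i" for i
    proof -
      have "f x \<in> \<Phi> (g i) ` V i"
        using f(2)[of i] V_in_P[of i] x_in_V[of i] unfolding agreeing_def by blast
      also have "\<dots> = V i"
        using g[of i] by (simp add: stabilizer_def)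
      finally show ?thesis .
    qed
    then have "f x = x"
      using V_Inter by blast
    moreover have "s = (\<lambda>i. agreeing i f)"
      using s agreeing_eq[OF f(2)] by auto
    ultimately show "s \<in> (\<lambda>f i. agreeing i f) ` {f \<in> ellis. f x = x}"
      using f(1) by blast
  qed
  ultimately show ?thesis
    unfolding eqpoll_def bij_betw_def by blast
qed

end

section \<open>Independence of the partitions and of the basepoint\<close>

lemma associated_group_chain_partition_chain:
  fixes G (structure)
  assumes "equicontinuous_compact_action G X \<Phi>" and "associated_group_chain G X \<Phi> x P Gs"
  obtains V where "partition_chain G X \<Phi> x V P"
    "Gs = (\<lambda>i. stabilizer G (\<lambda>g. image (\<Phi> g)) (V i))"
proof -
  obtain V where V: "V 0 = X \<and>
      (\<forall>i. V (Suc i) \<subset> V i) \<and>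
      (\<forall>i. openin (top_of_set X) (V i) \<and> closedin (top_of_set X) (V i)) \<and>
      (\<Inter>i. V i) = {x} \<and>
      (\<forall>i. P i = {\<Phi> g ` V i | g. g \<in> carrier G}) \<and>
      (\<forall>i. finite (P i) \<and> partition_on X (P i)) \<and>
      (\<forall>i\<ge>1. \<forall>g\<in>carrier G. diameter (\<Phi> g ` V i) < 1 / 2 ^ i) \<and>
      (\<forall>i. Gs i = stabilizer G (\<lambda>g. image (\<Phi> g)) (V i))"
    using assms(2) unfolding associated_group_chain_def by (elim conjE[of "group_chain G Gs"] exE) (rule that)
  have "partition_chain G X \<Phi> x V P"
  proof (intro partition_chain.intro assms(1) partition_chain_axioms.intro)
    show "V (Suc i) \<subseteq> V i" for i
      using V by blast
  qed (use V in blast)+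
  moreover have "Gs = (\<lambda>i. stabilizer G (\<lambda>g. image (\<Phi> g)) (V i))"
    by (rule ext) (use V in blast)
  ultimately show thesis
    by (rule that)
qed

theorem corollary1p9:
  fixes G :: "('g, 'm) monoid_scheme"
    and X :: "'a::metric_space set"
    and \<Phi> :: "'g \<Rightarrow> 'a \<Rightarrow> 'a"
    and x x' :: 'a
    and P P' :: "nat \<Rightarrow> 'a set set"
    and Gs Gs' :: "nat \<Rightarrow> 'g set"
  assumes "finitely_generated_group G"
    and "infinite (carrier G)"
    and "cantor_set X"
    and "action_by_homeomorphisms G X \<Phi>"
    and "minimal_action G X \<Phi>"
    and "equicontinuous_action G X \<Phi>"
    and "x \<in> X" and "associated_group_chain G X \<Phi> x P Gs"
    and "x' \<in> X" and "associated_group_chain G X \<Phi> x' P' Gs'"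
  shows "carrier (discriminant_group G Gs) \<approx> carrier (discriminant_group G Gs')"
proof -
  interpret equicontinuous_compact_action G X \<Phi>
    using assms by unfold_locales (auto simp: cantor_set_def)
  obtain V where V: "partition_chain G X \<Phi> x V P"
    "Gs = (\<lambda>i. stabilizer G (\<lambda>g. image (\<Phi> g)) (V i))"
    using associated_group_chain_partition_chain[OF equicontinuous_compact_action_axioms assms(8)] .
  obtain V' where V': "partition_chain G X \<Phi> x' V' P'"
    "Gs' = (\<lambda>i. stabilizer G (\<lambda>g. image (\<Phi> g)) (V' i))"
    using associated_group_chain_partition_chain[OF equicontinuous_compact_action_axioms assms(10)] .
  \<comment> \<open>\<open>ellis\<close> depends on the action alone, so both chains are compared
    inside the same group.\<close>
  obtain h where h: "h \<in> ellis" "h x = x'"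
    using partition_chain.ellis_transitive[OF V(1) assms(5,9)] .
  have "carrier (discriminant_group G Gs) \<approx> {f \<in> ellis. f x = x}"
    unfolding V(2)
    by (rule eqpoll_sym[OF partition_chain.discriminant_group_eqpoll_ellis_isotropy[OF V(1)]])
  also have "\<dots> \<approx> {f \<in> ellis. f x' = x'}"
    using ellis_isotropy_conjugate[OF h(1) assms(7,9) h(2)] .
  also have "\<dots> \<approx> carrier (discriminant_group G Gs')"
    unfolding V'(2)
    by (rule partition_chain.discriminant_group_eqpoll_ellis_isotropy[OF V'(1)])
  finally show ?thesis .
qed

end
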